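(* Let $q\in\mathbb{C}$ with $|q|<1$, and let $a,b,c,d,t,x,y$ be complex numbers. If $\max\{|c|,|ab|,|tx|,|ty|\}<1$ and $cd=ab$, then $$\sum_{n=0}^\infty\frac{(c;q)_n\,\Phi_n^{(a,b)}(x,y|q)\,t^n}{(q,ab;q)_n}=\frac{(c,axt,byt;q)_\infty}{(ab,tx,ty;q)_\infty}\;{}_3\phi_2\left({d,\,xt,\,yt\atop axt,\,byt};q,c\right).$$
   Context: For $a\in\mathbb{C}$: $(a;q)_0=1$, $(a;q)_n=\prod_{i=0}^{n-1}(1-aq^i)$, $(a;q)_\infty=\prod_{i=0}^\infty(1-aq^i)$, and $(a_1,\ldots,a_m;q)_n=(a_1;q)_n\cdots(a_m;q)_n$ for $n$ a nonnegative integer or $\infty$. The $q$-binomial coefficient is ${n\brack k}_q=\frac{(q;q)_n}{(q;q)_k(q;q)_{n-k}}$, and $\Phi_n^{(\alpha,\beta)}(x,y|q)=\sum_{k=0}^n {n\brack k}_q(\alpha;q)_k(\beta;q)_{n-k}x^ky^{n-k}$. The basic hypergeometric series here is ${}_3\phi_2\left({a_1,a_2,a_3\atop b_1,b_2};q,z\right)=\sum_{n=0}^\infty\frac{(a_1,a_2,a_3;q)_n}{(q,b_1,b_2;q)_n}z^n$. *)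

theory Defs
  imports "HOL-Analysis.Analysis"
begin

definition qpoch :: "complex \<Rightarrow> complex \<Rightarrow> nat \<Rightarrow> complex" where
  "qpoch a q n = (\<Prod>i<n. 1 - a * q ^ i)"

text \<open>
  For \<open>norm q < 1\<close> the product converges in the sense of \<open>convergent_prod\<close>,
  which tolerates finitely many vanishing factors; in that case \<open>prodinf\<close> is 0.
\<close>

definition qpoch_inf :: "complex \<Rightarrow> complex \<Rightarrow> complex" where
  "qpoch_inf a q = (\<Prod>i. 1 - a * q ^ i)"

definition qpochs :: "complex list \<Rightarrow> complex \<Rightarrow> nat \<Rightarrow> complex" where
  "qpochs as q n = (\<Prod>a\<leftarrow>as. qpoch a q n)"

definition qpochs_inf :: "complex list \<Rightarrow> complex \<Rightarrow> complex" where
  "qpochs_inf as q = (\<Prod>a\<leftarrow>as. qpoch_inf a q)"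

definition qbinomial :: "complex \<Rightarrow> nat \<Rightarrow> nat \<Rightarrow> complex" where
  "qbinomial q n k = qpoch q q n / (qpoch q q k * qpoch q q (n - k))"

definition Phi :: "nat \<Rightarrow> complex \<Rightarrow> complex \<Rightarrow> complex \<Rightarrow> complex \<Rightarrow> complex \<Rightarrow> complex" where
  "Phi n \<alpha> \<beta> x y q =
     (\<Sum>k\<le>n. qbinomial q n k * qpoch \<alpha> q k * qpoch \<beta> q (n - k) * x ^ k * y ^ (n - k))"

definition phi32_term ::
  "complex \<Rightarrow> complex \<Rightarrow> complex \<Rightarrow> complex \<Rightarrow> complex \<Rightarrow> complex \<Rightarrow> complex \<Rightarrow> nat \<Rightarrow> complex" where
  "phi32_term a1 a2 a3 b1 b2 q z n =
     qpochs [a1, a2, a3] q n / qpochs [q, b1, b2] q n * z ^ n"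

text \<open>
  As usual, the series is only meaningful when no denominator factor vanishes, i.e.
  \<open>qpoch b1 q n \<noteq> 0\<close> and \<open>qpoch b2 q n \<noteq> 0\<close> for all \<open>n\<close>
  (\<open>qpoch q q n\<close> is never 0 for \<open>norm q < 1\<close>).
\<close>

definition phi32 ::
  "complex \<Rightarrow> complex \<Rightarrow> complex \<Rightarrow> complex \<Rightarrow> complex \<Rightarrow> complex \<Rightarrow> complex \<Rightarrow> complex" where
  "phi32 a1 a2 a3 b1 b2 q z = (\<Sum>n. phi32_term a1 a2 a3 b1 b2 q z n)"

end

theory Submission
  imports Defs
begin

text \<open>
  The identity is a double series summed in two orders, and both inner sums are instances of the
  \<open>q\<close>-binomial theorem
  \<open>(\<Sum>k. (d; q)\<^sub>k / (q; q)\<^sub>k z\<^sup>k) = (d z; q)\<^sub>\<infinity> / (z; q)\<^sub>\<infinity>\<close>, valid for \<open>\<bar>z\<bar> < 1\<close>.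

  Splitting the infinite products after \<open>n\<close> factors gives
  \<open>(c; q)\<^sub>n / (a b; q)\<^sub>n = (c; q)\<^sub>\<infinity> / (a b; q)\<^sub>\<infinity> \<cdot> (a b q\<^sup>n; q)\<^sub>\<infinity> / (c q\<^sup>n; q)\<^sub>\<infinity>\<close>.
  Since \<open>a b = d c\<close>, the last quotient is a \<open>q\<close>-binomial series in \<open>c q\<^sup>n\<close> with parameter \<open>d\<close>.
  Inserting it turns the left-hand side into a double series whose \<open>(n, k)\<close> term contains
  \<open>n\<close> only through \<open>\<Phi>\<^sub>n (t q\<^sup>k)\<^sup>n / (q; q)\<^sub>n\<close>. These coefficients are the Cauchy product of
  two \<open>q\<close>-binomial series (\<open>Phi_generating_function\<close>), so summing over \<open>n\<close> first leaves
  \<open>(a x t q\<^sup>k, b y t q\<^sup>k; q)\<^sub>\<infinity> / (x t q\<^sup>k, y t q\<^sup>k; q)\<^sub>\<infinity>\<close>. Splitting off the first \<open>k\<close> factors of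
  each product produces the \<open>k\<close>-th term of the \<open>3\<phi>2\<close> series times a constant.

  The exchange of summations (\<open>sums_swap\<close>) is legitimate because \<open>\<bar>q\<^sup>n\<^sup>k\<bar> \<le> 1\<close>, so the double
  series is dominated by the product of two absolutely convergent single series. The
  \<open>q\<close>-binomial theorem itself follows from the functional equation
  \<open>(1 - z) f(z) = (1 - a z) f(q z)\<close>, iterated until the argument shrinks to 0.
\<close>

section \<open>Finite and infinite shifted factorials\<close>

lemma convergent_prod_qpoch:
  assumes "norm (q :: complex) < 1"
  shows "convergent_prod (\<lambda>i. 1 - a * q ^ i)"
proof -
  have "summable (\<lambda>i. norm (a * q ^ i))"
    using assms by (simp add: norm_mult norm_power summable_mult summable_geometric)
  then show ?thesis
    by (intro abs_convergent_prod_imp_convergent_prod summable_imp_abs_convergent_prod) simp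
qed

lemma qpoch_LIMSEQ:
  assumes "norm q < 1"
  shows "(\<lambda>n. qpoch a q n) \<longlonglongrightarrow> qpoch_inf a q"
  using convergent_prod_LIMSEQ[OF convergent_prod_qpoch[OF assms]]
  by (simp add: qpoch_def qpoch_inf_def LIMSEQ_lessThan_iff_atMost)

lemma qpoch_Suc: "qpoch a q (Suc n) = qpoch a q n * (1 - a * q ^ n)"
  by (simp add: qpoch_def)

lemma qpoch_add: "qpoch a q (m + n) = qpoch a q m * qpoch (a * q ^ m) q n"
  by (induction n) (simp_all add: qpoch_def power_add mult.assoc)

lemma qpoch_inf_split:
  assumes "norm q < 1"
  shows "qpoch_inf a q = qpoch a q m * qpoch_inf (a * q ^ m) q"
proof (rule LIMSEQ_unique)
  show "(\<lambda>n. qpoch a q (n + m)) \<longlonglongrightarrow> qpoch_inf a q"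
    using qpoch_LIMSEQ[OF assms] by (rule LIMSEQ_ignore_initial_segment)
  show "(\<lambda>n. qpoch a q (n + m)) \<longlonglongrightarrow> qpoch a q m * qpoch_inf (a * q ^ m) q"
    unfolding add.commute[of _ m] qpoch_add by (intro tendsto_mult_left qpoch_LIMSEQ assms)
qed

text \<open>
  Nonzero partial products could still tend to 0; this is excluded by the convergence of the
  infinite product in the strict sense, which requires a nonzero limit after dropping finitely
  many factors.
\<close>

lemma qpoch_inf_nonzero:
  assumes "norm q < 1" "\<And>n. qpoch a q n \<noteq> 0"
  shows "qpoch_inf a q \<noteq> 0"
proof -
  have "1 - a * q ^ i \<noteq> 0" for i
    using assms(2)[of "Suc i"] by (simp add: qpoch_Suc)
  then show ?thesis
    unfolding qpoch_inf_def
    using prodinf_nonzero[OF convergent_prod_qpoch[OF assms(1)]] by blast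
qed

lemma qpoch_nonzero:
  assumes "norm q < 1" "norm a < 1"
  shows "qpoch a q n \<noteq> 0"
proof -
  have "a * q ^ i \<noteq> 1" for i
  proof
    assume "a * q ^ i = 1"
    then have "norm a * norm q ^ i = 1" by (metis norm_mult norm_power norm_one)
    moreover have "norm a * norm q ^ i \<le> norm a"
      using assms by (intro mult_left_le power_le_one) auto
    ultimately show False using assms by simp
  qed
  then show ?thesis by (simp add: qpoch_def)
qed

lemma norm_mult_power_less_1:
  fixes q z :: complex
  assumes "norm q < 1" "norm z < 1"
  shows "norm (z * q ^ n) < 1"
proof -
  have "norm z * norm q ^ n \<le> norm z"
    using assms by (intro mult_left_le power_le_one) auto
  then show ?thesis using assms by (simp add: norm_mult norm_power)
qed

section \<open>The q-binomial theorem\<close>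

text \<open>The coefficients of the series \<open>1\<phi>0(a; -; q, z)\<close>.\<close>

definition qbin_coeff :: "complex \<Rightarrow> complex \<Rightarrow> nat \<Rightarrow> complex" where
  "qbin_coeff a q n = qpoch a q n / qpoch q q n"

lemma qbin_coeff_recurrence:
  assumes "norm q < 1"
  shows "qbin_coeff a q (Suc n) * (1 - q ^ Suc n) = qbin_coeff a q n * (1 - a * q ^ n)"
  using qpoch_nonzero[OF assms assms, of n] qpoch_nonzero[OF assms assms, of "Suc n"]
  by (simp add: qbin_coeff_def qpoch_Suc field_simps)

lemma qbin_coeff_ratio_tendsto:
  fixes q a :: complex
  assumes "norm q < 1"
  shows "(\<lambda>n. (1 - a * q ^ n) / (1 - q ^ Suc n)) \<longlonglongrightarrow> 1"
proof -
  have "(\<lambda>n. (1 - a * q ^ n) / (1 - q ^ Suc n)) \<longlonglongrightarrow> (1 - a * 0) / (1 - 0)"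
    by (intro tendsto_intros LIMSEQ_power_zero assms LIMSEQ_Suc[OF LIMSEQ_power_zero[OF assms]])
      auto
  then show ?thesis by simp
qed

text \<open>
  Consecutive coefficients have a ratio tending to 1, so the radius of convergence is at least 1.
\<close>

lemma summable_norm_qbin:
  assumes "norm q < 1" "norm z < 1"
  shows "summable (\<lambda>n. norm (qbin_coeff a q n * z ^ n))"
proof -
  obtain r where r: "norm z < r" "r < 1"
    using dense assms(2) by blast
  have "(\<lambda>n. norm ((1 - a * q ^ n) / (1 - q ^ Suc n)) * norm z) \<longlonglongrightarrow> norm (1::complex) * norm z"
    by (intro tendsto_mult_right tendsto_norm qbin_coeff_ratio_tendsto assms)
  then have "(\<lambda>n. norm ((1 - a * q ^ n) / (1 - q ^ Suc n)) * norm z) \<longlonglongrightarrow> norm z" by simp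
  then have "eventually (\<lambda>n. norm ((1 - a * q ^ n) / (1 - q ^ Suc n)) * norm z < r) sequentially"
    using r(1) by (rule order_tendstoD(2))
  then obtain N where N: "\<And>n. n \<ge> N \<Longrightarrow> norm ((1 - a * q ^ n) / (1 - q ^ Suc n)) * norm z < r"
    by (auto simp: eventually_sequentially)
  have step: "norm (qbin_coeff a q (Suc n) * z ^ Suc n) \<le> r * norm (qbin_coeff a q n * z ^ n)"
    if "n \<ge> N" for n
  proof -
    have "1 - q ^ Suc n \<noteq> 0"
      using norm_mult_power_less_1[OF assms(1) assms(1), of n] by auto
    then have "qbin_coeff a q (Suc n) = qbin_coeff a q n * ((1 - a * q ^ n) / (1 - q ^ Suc n))"
      using qbin_coeff_recurrence[OF assms(1), of a n] by (simp add: field_simps)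
    then have "norm (qbin_coeff a q (Suc n) * z ^ Suc n) =
        (norm ((1 - a * q ^ n) / (1 - q ^ Suc n)) * norm z) * norm (qbin_coeff a q n * z ^ n)"
      by (simp only: norm_mult power_Suc) (simp only: mult_ac)
    also have "\<dots> \<le> r * norm (qbin_coeff a q n * z ^ n)"
      using N[OF that] by (intro mult_right_mono) auto
    finally show ?thesis .
  qed
  show ?thesis
    by (rule summable_ratio_test[OF r(2), of N]) (use step in auto)
qed

definition qbin_series :: "complex \<Rightarrow> complex \<Rightarrow> complex \<Rightarrow> complex" where
  "qbin_series a q z = (\<Sum>n. qbin_coeff a q n * z ^ n)"

lemma sums_qbin_series:
  assumes "norm q < 1" "norm z < 1"
  shows "(\<lambda>n. qbin_coeff a q n * z ^ n) sums qbin_series a q z"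
  unfolding qbin_series_def
  by (rule summable_sums[OF summable_norm_cancel[OF summable_norm_qbin[OF assms]]])

text \<open>
  The coefficients of \<open>f(z) - f(z q)\<close> are \<open>A\<^sub>n (1 - q\<^sup>n)\<close>. Their constant term vanishes, and the
  recurrence \<open>A\<^sub>n\<^sub>+\<^sub>1 (1 - q\<^sup>n\<^sup>+\<^sup>1) = A\<^sub>n (1 - a q\<^sup>n)\<close> rewrites the others in terms of \<open>A\<^sub>n\<close>, so
  \<open>f(z) - f(z q) = z (f(z) - a f(z q))\<close>.
\<close>

lemma qbin_series_functional_equation:
  assumes "norm q < 1" "norm z < 1"
  shows "(1 - z) * qbin_series a q z = (1 - a * z) * qbin_series a q (z * q)"
proof -
  let ?A = "qbin_coeff a q"
  have zq: "norm (z * q) < 1"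
    using norm_mult_power_less_1[OF assms, of 1] by simp
  have s1: "(\<lambda>n. ?A n * z ^ n) sums qbin_series a q z"
    by (rule sums_qbin_series[OF assms])
  have s2: "(\<lambda>n. ?A n * (z * q) ^ n) sums qbin_series a q (z * q)"
    by (rule sums_qbin_series[OF assms(1) zq])
  have L: "(\<lambda>n. ?A n * z ^ n - ?A n * (z * q) ^ n) sums
      (qbin_series a q z - qbin_series a q (z * q))"
    by (intro sums_diff s1 s2)
  have "(\<lambda>n. ?A (Suc n) * z ^ Suc n - ?A (Suc n) * (z * q) ^ Suc n) sums
      (qbin_series a q z - qbin_series a q (z * q))"
    using L by (subst sums_Suc_iff) simp
  moreover have "?A (Suc n) * z ^ Suc n - ?A (Suc n) * (z * q) ^ Suc n =
      z * (?A n * z ^ n - a * (?A n * (z * q) ^ n))" for n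
  proof -
    have "?A (Suc n) * z ^ Suc n - ?A (Suc n) * (z * q) ^ Suc n =
        z ^ Suc n * (?A (Suc n) * (1 - q ^ Suc n))"
      by (simp add: power_mult_distrib algebra_simps)
    also have "\<dots> = z * (?A n * z ^ n - a * (?A n * (z * q) ^ n))"
      unfolding qbin_coeff_recurrence[OF assms(1)] by (simp add: power_mult_distrib algebra_simps)
    finally show ?thesis .
  qed
  ultimately have "(\<lambda>n. z * (?A n * z ^ n - a * (?A n * (z * q) ^ n))) sums
      (qbin_series a q z - qbin_series a q (z * q))"
    by simp
  moreover have "(\<lambda>n. z * (?A n * z ^ n - a * (?A n * (z * q) ^ n))) sums
      (z * (qbin_series a q z - a * qbin_series a q (z * q)))"
    by (intro sums_mult sums_diff s1 s2)
  ultimately have "qbin_series a q z - qbin_series a q (z * q) =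
      z * (qbin_series a q z - a * qbin_series a q (z * q))"
    by (rule sums_unique2)
  then show ?thesis by (simp add: algebra_simps)
qed

lemma qbin_series_iterate:
  assumes "norm q < 1" "norm z < 1"
  shows "qpoch z q n * qbin_series a q z = qpoch (a * z) q n * qbin_series a q (z * q ^ n)"
proof (induction n)
  case (Suc n)
  have "qpoch z q (Suc n) * qbin_series a q z =
      (1 - z * q ^ n) * (qpoch z q n * qbin_series a q z)"
    by (simp add: qpoch_Suc)
  also have "\<dots> = qpoch (a * z) q n * ((1 - z * q ^ n) * qbin_series a q (z * q ^ n))"
    unfolding Suc.IH by simp
  also have "\<dots> = qpoch (a * z) q (Suc n) * qbin_series a q (z * q ^ Suc n)"
    unfolding qbin_series_functional_equation[OF assms(1) norm_mult_power_less_1[OF assms]]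
    by (simp add: qpoch_Suc mult_ac)
  finally show ?case .
qed (simp add: qpoch_def)

text \<open>
  In \<open>(z; q)\<^sub>n f(z) = (a z; q)\<^sub>n f(z q\<^sup>n)\<close> the limit \<open>n \<rightarrow> \<infinity>\<close> can be taken on both sides, because
  \<open>f\<close> is continuous at 0 with \<open>f(0) = 1\<close>.
\<close>

theorem q_binomial:
  assumes "norm q < 1" "norm z < 1"
  shows "(\<lambda>n. qbin_coeff a q n * z ^ n) sums (qpoch_inf (a * z) q / qpoch_inf z q)"
proof -
  have "isCont (\<lambda>z. \<Sum>n. qbin_coeff a q n * z ^ n) 0"
  proof (rule isCont_powser)
    show "summable (\<lambda>n. qbin_coeff a q n * (1 / 2) ^ n)"
      using sums_summable[OF sums_qbin_series[OF assms(1), of "1 / 2" a]] by simp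
    show "norm (0 :: complex) < norm (1 / 2 :: complex)"
      by simp
  qed
  then have "isCont (qbin_series a q) 0" by (simp add: qbin_series_def[abs_def])
  moreover have "(\<lambda>n. z * q ^ n) \<longlonglongrightarrow> 0"
    using tendsto_mult_left[OF LIMSEQ_power_zero[OF assms(1)], of z] by simp
  ultimately have "(\<lambda>n. qbin_series a q (z * q ^ n)) \<longlonglongrightarrow> qbin_series a q 0"
    by (rule isCont_tendsto_compose)
  moreover have "qbin_series a q 0 = 1"
    unfolding qbin_series_def powser_zero by (simp add: qbin_coeff_def qpoch_def)
  ultimately have "(\<lambda>n. qpoch (a * z) q n * qbin_series a q (z * q ^ n)) \<longlonglongrightarrow>
      qpoch_inf (a * z) q * 1"
    by (intro tendsto_mult qpoch_LIMSEQ assms) simp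
  moreover have "(\<lambda>n. qpoch z q n * qbin_series a q z) \<longlonglongrightarrow> qpoch_inf z q * qbin_series a q z"
    by (intro tendsto_mult_right qpoch_LIMSEQ assms)
  ultimately have "qpoch_inf z q * qbin_series a q z = qpoch_inf (a * z) q * 1"
    unfolding qbin_series_iterate[OF assms] by (metis LIMSEQ_unique)
  moreover have "qpoch_inf z q \<noteq> 0"
    by (intro qpoch_inf_nonzero qpoch_nonzero assms)
  ultimately have "qbin_series a q z = qpoch_inf (a * z) q / qpoch_inf z q"
    by (simp add: field_simps)
  moreover have "(\<lambda>n. qbin_coeff a q n * z ^ n) sums qbin_series a q z"
    by (rule sums_qbin_series[OF assms])
  ultimately show ?thesis by simp
qed

section \<open>The generating function of Phi\<close>

text \<open>
  The factor \<open>(q; q)\<^sub>n\<close> of the \<open>q\<close>-binomial coefficient cancels, and what remains separates into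
  a factor depending on \<open>k\<close> and one depending on \<open>n - k\<close>.
\<close>

lemma Phi_Cauchy_product:
  assumes "norm q < 1"
  shows "Phi n a b x y q * t ^ n / qpoch q q n =
    (\<Sum>k\<le>n. (qbin_coeff a q k * (t * x) ^ k) * (qbin_coeff b q (n - k) * (t * y) ^ (n - k)))"
  unfolding Phi_def sum_distrib_right sum_divide_distrib
proof (rule sum.cong[OF refl])
  fix k assume "k \<in> {..n}"
  then have "t ^ n = t ^ k * t ^ (n - k)" by (simp flip: power_add)
  then show "qbinomial q n k * qpoch a q k * qpoch b q (n - k) * x ^ k * y ^ (n - k) * t ^ n /
      qpoch q q n =
      qbin_coeff a q k * (t * x) ^ k * (qbin_coeff b q (n - k) * (t * y) ^ (n - k))"
    using qpoch_nonzero[OF assms assms, of n]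
    by (simp add: qbinomial_def qbin_coeff_def power_mult_distrib)
qed

lemma Phi_generating_function:
  assumes "norm q < 1" "norm (t * x) < 1" "norm (t * y) < 1"
  shows "(\<lambda>n. Phi n a b x y q * t ^ n / qpoch q q n) sums
    (qpoch_inf (a * (t * x)) q / qpoch_inf (t * x) q *
     (qpoch_inf (b * (t * y)) q / qpoch_inf (t * y) q))"
  unfolding Phi_Cauchy_product[OF assms(1)]
  using Cauchy_product_sums[OF summable_norm_qbin[OF assms(1,2), of a]
      summable_norm_qbin[OF assms(1,3), of b]]
  by (simp add: sums_unique[OF q_binomial[OF assms(1,2)], symmetric]
      sums_unique[OF q_binomial[OF assms(1,3)], symmetric])

lemma summable_norm_Phi:
  assumes "norm q < 1" "norm (t * x) < 1" "norm (t * y) < 1"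
  shows "summable (\<lambda>n. norm (Phi n a b x y q * t ^ n / qpoch q q n))"
proof (rule summable_comparison_test')
  show "summable (\<lambda>n. \<Sum>k\<le>n. norm (qbin_coeff a q k * (t * x) ^ k) *
      norm (qbin_coeff b q (n - k) * (t * y) ^ (n - k)))"
    using summable_norm_qbin[OF assms(1,2), of a] summable_norm_qbin[OF assms(1,3), of b]
    by (intro summable_Cauchy_product) simp_all
  show "norm (norm (Phi n a b x y q * t ^ n / qpoch q q n)) \<le>
      (\<Sum>k\<le>n. norm (qbin_coeff a q k * (t * x) ^ k) *
        norm (qbin_coeff b q (n - k) * (t * y) ^ (n - k)))" if "n \<ge> 0" for n
    unfolding Phi_Cauchy_product[OF assms(1)] real_norm_def abs_norm_cancel
    by (rule order_trans[OF norm_sum]) (simp only: norm_mult order_refl)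
qed

section \<open>Exchanging the order of summation\<close>

text \<open>
  Fubini's theorem for series. The summability of the column sums is part of the conclusion: it
  is what yields convergence of the \<open>3\<phi>2\<close> series below.
\<close>

lemma sums_swap:
  fixes F :: "nat \<Rightarrow> nat \<Rightarrow> 'a :: banach"
  assumes bound: "\<And>n k. norm (F n k) \<le> A n * B k"
    and A: "summable A" "\<And>n. A n \<ge> 0" and B: "summable B" "\<And>k. B k \<ge> 0"
    and rows: "\<And>n. (\<lambda>k. F n k) sums G n" and cols: "\<And>k. (\<lambda>n. F n k) sums H k"
  shows "summable H" "G sums (\<Sum>k. H k)"
proof -
  have "(\<lambda>(n, k). A n * B k) summable_on UNIV \<times> UNIV"
  proof (rule summable_on_SigmaI)
    show "((\<lambda>k. case (n, k) of (n, k) \<Rightarrow> A n * B k) has_sum A n * suminf B) UNIV" for n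
      using summable_sums[OF summable_mult[OF B(1), of "A n"]] A B
      by (auto simp: suminf_mult intro!: sums_nonneg_imp_has_sum)
    show "(\<lambda>n. A n * suminf B) summable_on UNIV"
      using A B by (intro norm_summable_imp_summable_on)
        (simp add: norm_mult abs_mult suminf_nonneg summable_mult2)
  qed (use A B in auto)
  then have "(\<lambda>(n, k). F n k) abs_summable_on UNIV \<times> UNIV"
    by (rule summable_on_comparison_test) (use bound in auto)
  then have "(\<lambda>(n, k). F n k) summable_on UNIV \<times> UNIV"
    by (rule abs_summable_summable)
  then obtain S where S: "((\<lambda>(n, k). F n k) has_sum S) (UNIV \<times> UNIV)"
    by (auto simp: summable_on_def)
  have rows': "((\<lambda>k. F n k) has_sum G n) UNIV" for n
  proof (rule norm_summable_imp_has_sum[OF _ rows])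
    show "summable (\<lambda>k. norm (F n k))"
      by (rule summable_comparison_test'[OF summable_mult[OF B(1), of "A n"]]) (use bound in auto)
  qed
  have cols': "((\<lambda>n. F n k) has_sum H k) UNIV" for k
  proof (rule norm_summable_imp_has_sum[OF _ cols])
    show "summable (\<lambda>n. norm (F n k))"
      by (rule summable_comparison_test'[OF summable_mult2[OF A(1), of "B k"]]) (use bound in auto)
  qed
  have "(G has_sum S) UNIV"
    using has_sum_SigmaD[OF S] rows' by simp
  then have G: "G sums S" by (rule has_sum_imp_sums)
  have "((\<lambda>(k, n). F n k) has_sum S) (UNIV \<times> UNIV)"
    using S has_sum_swap[of "\<lambda>(n, k). F n k" UNIV UNIV S] by simp
  then have "(H has_sum S) UNIV"
    using has_sum_SigmaD[of "\<lambda>(k, n). F n k"] cols' by fastforce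
  then have "H sums S" by (rule has_sum_imp_sums)
  with G show "summable H" "G sums (\<Sum>k. H k)" by (auto simp: sums_iff)
qed

section \<open>The transformation formula\<close>

theorem theorem3p3:
  fixes q a b c d t x y :: complex
  assumes "norm q < 1"
    and "Max {norm c, norm (a * b), norm (t * x), norm (t * y)} < 1"
    and "c * d = a * b"
    and "\<And>n. qpoch (a * x * t) q n \<noteq> 0"
    and "\<And>n. qpoch (b * y * t) q n \<noteq> 0"
  shows "summable (phi32_term d (x * t) (y * t) (a * x * t) (b * y * t) q c) \<and>
         (\<lambda>n. qpoch c q n * Phi n a b x y q * t ^ n / qpochs [q, a * b] q n) sums
           (qpochs_inf [c, a * x * t, b * y * t] q / qpochs_inf [a * b, t * x, t * y] q *
            phi32 d (x * t) (y * t) (a * x * t) (b * y * t) q c)"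
proof -
  note q = assms(1)
  have c: "norm c < 1" and ab: "norm (a * b) < 1" and tx: "norm (t * x) < 1"
    and ty: "norm (t * y) < 1"
    using assms(2) by simp_all
  define P where "P n = Phi n a b x y q * t ^ n / qpoch q q n" for n
  define F where "F n k = P n * (qbin_coeff d q k * (c * q ^ n) ^ k)" for n k
  define K where "K = qpoch_inf (a * x * t) q * qpoch_inf (b * y * t) q /
    (qpoch_inf (t * x) q * qpoch_inf (t * y) q)"
  let ?T = "phi32_term d (x * t) (y * t) (a * x * t) (b * y * t) q c"
  note nz = qpoch_nonzero[OF q] and nzi = qpoch_inf_nonzero[OF q qpoch_nonzero[OF q]]
  \<comment> \<open>Only because \<open>K\<close> is nonzero does summability of the column sums \<open>K * ?T k\<close> pass to \<open>?T\<close>.\<close>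
  have K0: "K \<noteq> 0"
    using qpoch_inf_nonzero[OF q assms(4)] qpoch_inf_nonzero[OF q assms(5)] nzi[OF tx] nzi[OF ty]
    by (simp add: K_def)
  have bound: "norm (F n k) \<le> norm (P n) * norm (qbin_coeff d q k * c ^ k)" for n k
  proof -
    have "norm (F n k) = norm (P n) * norm (qbin_coeff d q k * c ^ k) * norm q ^ (n * k)"
      by (simp add: F_def norm_mult norm_power power_mult_distrib power_mult)
    also have "\<dots> \<le> norm (P n) * norm (qbin_coeff d q k * c ^ k)"
      using q by (intro mult_left_le power_le_one) auto
    finally show ?thesis .
  qed
  have rows: "(\<lambda>k. F n k) sums
      (qpoch_inf (a * b) q / qpoch_inf c q *
        (qpoch c q n * Phi n a b x y q * t ^ n / qpochs [q, a * b] q n))" for n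
  proof -
    have dc: "d * (c * q ^ n) = a * b * q ^ n" using assms(3) by (simp add: mult_ac)
    have "(\<lambda>k. F n k) sums (P n * (qpoch_inf (a * b * q ^ n) q / qpoch_inf (c * q ^ n) q))"
      unfolding F_def
      using sums_mult[OF q_binomial[OF q norm_mult_power_less_1[OF q c], of d n], of "P n"]
      by (simp only: dc)
    moreover have "P n * (qpoch_inf (a * b * q ^ n) q / qpoch_inf (c * q ^ n) q) =
        qpoch_inf (a * b) q / qpoch_inf c q *
        (qpoch c q n * Phi n a b x y q * t ^ n / qpochs [q, a * b] q n)"
      using nz[OF ab, of n] nz[OF c, of n]
      unfolding qpoch_inf_split[OF q, of "a * b" n] qpoch_inf_split[OF q, of c n]
      by (simp add: P_def qpochs_def mult_ac)
    ultimately show ?thesis by simp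
  qed
  have cols: "(\<lambda>n. F n k) sums (K * ?T k)" for k
  proof -
    have tq: "norm (t * q ^ k * x) < 1" "norm (t * q ^ k * y) < 1"
      using norm_mult_power_less_1[OF q tx, of k] norm_mult_power_less_1[OF q ty, of k]
      by (simp_all add: mult_ac)
    have e: "a * (t * q ^ k * x) = a * x * t * q ^ k" "b * (t * q ^ k * y) = b * y * t * q ^ k"
      "t * q ^ k * x = t * x * q ^ k" "t * q ^ k * y = t * y * q ^ k"
      by (simp_all add: mult_ac)
    \<comment> \<open>Moving \<open>q ^ (n * k)\<close> from the power of \<open>c\<close> to that of \<open>t\<close> makes the sum over \<open>n\<close> a
      generating function evaluated at \<open>t * q ^ k\<close>.\<close>
    have F: "F n k = qbin_coeff d q k * c ^ k * (Phi n a b x y q * (t * q ^ k) ^ n / qpoch q q n)"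
      for n
      by (simp add: F_def P_def power_mult_distrib mult.commute[of n k] flip: power_mult)
    have "(\<lambda>n. F n k) sums (qbin_coeff d q k * c ^ k *
        (qpoch_inf (a * x * t * q ^ k) q / qpoch_inf (t * x * q ^ k) q *
        (qpoch_inf (b * y * t * q ^ k) q / qpoch_inf (t * y * q ^ k) q)))"
      unfolding F using sums_mult[OF Phi_generating_function[OF q tq, of a b],
          of "qbin_coeff d q k * c ^ k"]
      unfolding e(1,2) unfolding e(3,4) .
    moreover have "qbin_coeff d q k * c ^ k *
        (qpoch_inf (a * x * t * q ^ k) q / qpoch_inf (t * x * q ^ k) q *
        (qpoch_inf (b * y * t * q ^ k) q / qpoch_inf (t * y * q ^ k) q)) = K * ?T k"
      using assms(4)[of k] assms(5)[of k] nz[OF tx, of k] nz[OF ty, of k]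
      unfolding K_def qpoch_inf_split[OF q, of "a * x * t" k]
        qpoch_inf_split[OF q, of "b * y * t" k] qpoch_inf_split[OF q, of "t * x" k]
        qpoch_inf_split[OF q, of "t * y" k] phi32_term_def qpochs_def qbin_coeff_def
      by (simp add: mult.commute[of x t] mult.commute[of y t] mult_ac)
    ultimately show ?thesis by simp
  qed
  note sw = sums_swap[of F "\<lambda>n. norm (P n)" "\<lambda>k. norm (qbin_coeff d q k * c ^ k)",
      OF bound summable_norm_Phi[OF q tx ty, of a b, folded P_def] norm_ge_zero
        summable_norm_qbin[OF q c] norm_ge_zero rows cols]
  have sT: "summable ?T"
    using sw(1) K0 by (simp add: summable_cmult_iff)
  have "(\<lambda>n. qpoch_inf c q / qpoch_inf (a * b) q * (qpoch_inf (a * b) q / qpoch_inf c q *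
        (qpoch c q n * Phi n a b x y q * t ^ n / qpochs [q, a * b] q n))) sums
      (qpoch_inf c q / qpoch_inf (a * b) q * (K * (\<Sum>k. ?T k)))"
    using sums_mult[OF sw(2)] unfolding suminf_mult[OF sT] .
  then show ?thesis
    using sT nzi[OF c] nzi[OF ab] by (simp add: K_def qpochs_inf_def phi32_def mult_ac)
qed

end
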